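(* Assume $K(x,y)>0$, $\mu(x)>0$, $\nu(y)>0$ for all $x,y\in S$. Let $g_0\in\mathcal H$ and $\mathcal C_{g_0}=\{g\in\mathcal H:\mathcal J(g)\le\mathcal J(g_0)\}$. There exists $\lambda_{g_0}>0$ such that, for all $g\in\mathcal C_{g_0}$ and all $f:S\to\mathbb R$ with $\mathbb E_\nu[f]=0$, $$\langle f,\mathsf K_g f\rangle\ge\lambda_{g_0}\|f\|_{L^2(\nu)}^2.$$
   Context: Let $N\ge1$ be an integer and $S=\{1,\dots,N\}$. Let $Q\in\mathbb R^{N\times N}$ be the generator of a continuous-time Markov chain on $S$ (nonnegative off-diagonal entries, rows summing to zero) and $K=e^{Q}$. Let $\mu,\nu$ be probability distributions on $S$. Functions on $S$ are identified with vectors in $\mathbb R^S$; $\langle\cdot,\cdot\rangle$ is the standard Euclidean inner product on $\mathbb R^S$; $\mathbb E_\nu[f]=\sum_{y\in S}\nu(y)f(y)$; $\|f\|_{L^2(\nu)}^2=\sum_{y\in S}\nu(y)f(y)^2$. For $g\in\mathbb R^S$ set $Z_g(x)=\sum_{z\in S}K(x,z)e^{g(z)}$, $p_g(y|x)=\frac{K(x,y)e^{g(y)}}{Z_g(x)}$, and $$\mathcal J(g)=\sum_{x\in S}\mu(x)\log Z_g(x)-\mathbb E_\nu[g].$$ The gauge-fixed space is $\mathcal H=\{g\in\mathbb R^S:\mathbb E_\nu[g]=0\}$. The operator $\mathsf K_g:\mathbb R^S\to\mathbb R^S$ is $$\mathsf K_g=\sum_{x\in S}\mu(x)\left[\operatorname{Diag}(p_g(\cdot|x))-p_g(\cdot|x)p_g(\cdot|x)^\top\right].$$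 *)

theory Defs
  imports "HOL-Analysis.Analysis"
begin

text \<open>
  The state space \<open>S = {1,...,N}\<close> is the universe of a type \<open>'n\<close> of class \<open>finite\<close>,
  so \<open>N = CARD('n) \<ge> 1\<close>.  Functions on \<open>S\<close> are vectors in \<open>real ^ 'n\<close>; for a matrix
  \<open>A\<close>, the entry \<open>A(x,y)\<close> is \<open>A $ x $ y\<close>.
\<close>

definition is_generator :: "real ^ 'n ^ 'n \<Rightarrow> bool" where
  "is_generator Q \<longleftrightarrow>
     (\<forall>x y. x \<noteq> y \<longrightarrow> 0 \<le> Q $ x $ y) \<and> (\<forall>x. (\<Sum>y\<in>UNIV. Q $ x $ y) = 0)"

text \<open>
  The overloaded multiplication on \<open>real ^ 'n ^ 'n\<close> is componentwise, so \<open>A ^ k\<close> is not the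
  matrix power, and the library function \<open>exp\<close> is not available at this type.
\<close>

definition mat_pow :: "real ^ 'n ^ 'n \<Rightarrow> nat \<Rightarrow> real ^ 'n ^ 'n" where
  "mat_pow A k = (((**) A) ^^ k) (mat 1)"

definition mat_exp :: "real ^ 'n ^ 'n \<Rightarrow> real ^ 'n ^ 'n" where
  "mat_exp A = (\<Sum>k. (1 / fact k) *\<^sub>R mat_pow A k)"

lemma mat_pow_entry_bound:
  fixes A :: "real ^ 'n ^ 'n"
  assumes M: "\<And>x y. \<bar>A $ x $ y\<bar> \<le> M"
  shows "\<bar>mat_pow A k $ x $ y\<bar> \<le> (real CARD('n) * M) ^ k"
proof (induction k arbitrary: x y)
  case 0
  show ?case by (simp add: mat_pow_def mat_def)
next
  case (Suc k)
  have M0: "0 \<le> M" using M[of x x] by linarith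
  have "\<bar>mat_pow A (Suc k) $ x $ y\<bar> = \<bar>\<Sum>z\<in>UNIV. A $ x $ z * mat_pow A k $ z $ y\<bar>"
    by (simp add: mat_pow_def matrix_matrix_mult_def)
  also have "\<dots> \<le> (\<Sum>z\<in>UNIV. \<bar>A $ x $ z * mat_pow A k $ z $ y\<bar>)"
    by (rule sum_abs)
  also have "\<dots> \<le> (\<Sum>z\<in>(UNIV :: 'n set). M * (real CARD('n) * M) ^ k)"
    by (intro sum_mono) (use M M0 Suc in \<open>auto simp: abs_mult intro!: mult_mono\<close>)
  also have "\<dots> = (real CARD('n) * M) ^ Suc k" by simp
  finally show ?case .
qed

lemma summable_mat_exp:
  fixes A :: "real ^ 'n ^ 'n"
  shows "summable (\<lambda>k. (1 / fact k) *\<^sub>R mat_pow A k)"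
proof -
  define M where "M = (\<Sum>x\<in>UNIV. \<Sum>y\<in>UNIV. \<bar>A $ x $ y\<bar>)"
  have M: "\<bar>A $ x $ y\<bar> \<le> M" for x y
  proof -
    have "\<bar>A $ x $ y\<bar> \<le> (\<Sum>y\<in>UNIV. \<bar>A $ x $ y\<bar>)"
      by (rule member_le_sum) auto
    also have "\<dots> \<le> M"
      unfolding M_def by (rule member_le_sum[where f = "\<lambda>x. \<Sum>y\<in>UNIV. \<bar>A $ x $ y\<bar>"])
        (auto intro: sum_nonneg)
    finally show ?thesis .
  qed
  define C where "C = real CARD('n) * M"
  have nb: "norm (mat_pow A k) \<le> (real CARD('n) * real CARD('n)) * C ^ k" for k
  proof -
    have "norm (mat_pow A k) \<le> (\<Sum>x\<in>UNIV. norm (mat_pow A k $ x))"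
      unfolding norm_vec_def by (rule L2_set_le_sum) simp
    also have "\<dots> \<le> (\<Sum>x\<in>(UNIV :: 'n set). \<Sum>y\<in>(UNIV :: 'n set). C ^ k)"
    proof (rule sum_mono)
      fix x
      have "norm (mat_pow A k $ x) \<le> (\<Sum>y\<in>UNIV. \<bar>mat_pow A k $ x $ y\<bar>)"
        by (rule norm_le_l1_cart)
      also have "\<dots> \<le> (\<Sum>y\<in>(UNIV :: 'n set). C ^ k)"
        by (rule sum_mono) (use mat_pow_entry_bound[OF M] in \<open>auto simp: C_def\<close>)
      finally show "norm (mat_pow A k $ x) \<le> (\<Sum>y\<in>(UNIV :: 'n set). C ^ k)" .
    qed
    finally show ?thesis by simp
  qed
  have "summable (\<lambda>k. (real CARD('n) * real CARD('n)) * (inverse (fact k) * C ^ k))"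
    by (intro summable_mult summable_exp)
  then show ?thesis
    by (rule summable_comparison_test')
      (use nb in \<open>auto simp: field_simps\<close>)
qed

definition is_prob_vec :: "real ^ 'n \<Rightarrow> bool" where
  "is_prob_vec \<mu> \<longleftrightarrow> (\<forall>x. 0 \<le> \<mu> $ x) \<and> (\<Sum>x\<in>UNIV. \<mu> $ x) = 1"

definition expect :: "real ^ 'n \<Rightarrow> real ^ 'n \<Rightarrow> real" where
  "expect \<nu> f = (\<Sum>y\<in>UNIV. \<nu> $ y * f $ y)"

definition L2_norm_sq :: "real ^ 'n \<Rightarrow> real ^ 'n \<Rightarrow> real" where
  "L2_norm_sq \<nu> f = (\<Sum>y\<in>UNIV. \<nu> $ y * (f $ y)\<^sup>2)"

definition Z :: "real ^ 'n ^ 'n \<Rightarrow> real ^ 'n \<Rightarrow> 'n \<Rightarrow> real" where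
  "Z K g x = (\<Sum>z\<in>UNIV. K $ x $ z * exp (g $ z))"

text \<open>\<open>tilted K g x\<close> is the vector \<open>p_g(. | x)\<close>.\<close>

definition tilted :: "real ^ 'n ^ 'n \<Rightarrow> real ^ 'n \<Rightarrow> 'n \<Rightarrow> real ^ 'n" where
  "tilted K g x = (\<chi> y. K $ x $ y * exp (g $ y) / Z K g x)"

definition J :: "real ^ 'n ^ 'n \<Rightarrow> real ^ 'n \<Rightarrow> real ^ 'n \<Rightarrow> real ^ 'n \<Rightarrow> real" where
  "J K \<mu> \<nu> g = (\<Sum>x\<in>UNIV. \<mu> $ x * ln (Z K g x)) - expect \<nu> g"

definition gauge_space :: "real ^ 'n \<Rightarrow> (real ^ 'n) set" where
  "gauge_space \<nu> = {g. expect \<nu> g = 0}"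

definition sublevel ::
  "real ^ 'n ^ 'n \<Rightarrow> real ^ 'n \<Rightarrow> real ^ 'n \<Rightarrow> real ^ 'n \<Rightarrow> (real ^ 'n) set" where
  "sublevel K \<mu> \<nu> g0 = {g \<in> gauge_space \<nu>. J K \<mu> \<nu> g \<le> J K \<mu> \<nu> g0}"

definition diag_mat :: "real ^ 'n \<Rightarrow> real ^ 'n ^ 'n" where
  "diag_mat v = (\<chi> i j. if i = j then v $ i else 0)"

definition outer_prod :: "real ^ 'n \<Rightarrow> real ^ 'n \<Rightarrow> real ^ 'n ^ 'n" where
  "outer_prod u v = (\<chi> i j. u $ i * v $ j)"

text \<open>\<open>K_op K \<mu> g\<close> is the matrix of the operator \<open>K_g\<close>.\<close>

definition K_op :: "real ^ 'n ^ 'n \<Rightarrow> real ^ 'n \<Rightarrow> real ^ 'n \<Rightarrow> real ^ 'n ^ 'n" where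
  "K_op K \<mu> g =
     (\<Sum>x\<in>UNIV. \<mu> $ x *\<^sub>R
        (diag_mat (tilted K g x) - outer_prod (tilted K g x) (tilted K g x)))"

end

theory Submission
  imports Defs
begin

text \<open>
  The quadratic form of \<open>K_op K \<mu> g\<close> at \<open>f\<close> is the \<open>\<mu>\<close>-average over \<open>x\<close> of the variances of \<open>f\<close>
  under the tilted laws \<open>tilted K g x\<close>.  A variance is monotone in the underlying law, in the
  following sense: if \<open>p \<ge> \<delta> \<nu>\<close> pointwise, then \<open>Var\<^sub>p f \<ge> \<delta> Var\<^sub>\<nu> f\<close>, because \<open>Var\<^sub>\<nu> f\<close> is the
  least second moment of \<open>f - m\<close> under \<open>\<nu>\<close> over all constants \<open>m\<close> (\<open>variance_comparison\<close>).  For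
  \<open>f\<close> centred under \<open>\<nu>\<close>, \<open>Var\<^sub>\<nu> f\<close> is the squared norm on the right-hand side.  So it suffices to
  bound the tilted probabilities away from zero, uniformly over the sublevel set; since \<open>\<nu> \<le> 1\<close>,
  such a bound is a possible value of the constant.

  This uniform bound comes from two-sided bounds on \<open>g\<close>.  Keeping only one term of the partition
  sum, \<open>Z K g x \<ge> K(x,z) exp (g z)\<close>, shows that on the gauge space \<open>J\<close> dominates \<open>g z\<close> up to an
  additive constant (\<open>sublevel_upper_bound\<close>).  The gauge condition then turns the upper bound on
  all coordinates into a lower bound on each one (\<open>centred_lower_bound\<close>), as \<open>\<nu>\<close> charges every
  point.  This makes every constant explicit, without an appeal to compactness.
\<close>

lemma Z_ge_single:
  assumes "\<And>x y. K $ x $ y > 0"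
  shows "K $ x $ z * exp (g $ z) \<le> Z K g x"
  unfolding Z_def
  by (rule member_le_sum[where f = "\<lambda>z. K $ x $ z * exp (g $ z)"])
    (use assms in \<open>auto intro: less_imp_le\<close>)

lemma Z_pos:
  assumes "\<And>x y. K $ x $ y > 0"
  shows "Z K g x > 0"
  unfolding Z_def using assms by (intro sum_pos) auto

lemma sum_tilted:
  assumes "\<And>x y. K $ x $ y > 0"
  shows "(\<Sum>y\<in>UNIV. tilted K g x $ y) = 1"
proof -
  have "(\<Sum>y\<in>UNIV. tilted K g x $ y) = (\<Sum>y\<in>UNIV. K $ x $ y * exp (g $ y)) / Z K g x"
    by (simp add: tilted_def sum_divide_distrib)
  also have "\<dots> = Z K g x / Z K g x"
    by (simp add: Z_def)
  finally show ?thesis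
    using Z_pos[OF assms, of g x] by simp
qed

lemma inner_covariance_matrix:
  "f \<bullet> ((diag_mat p - outer_prod p p) *v f)
     = (\<Sum>y\<in>UNIV. p $ y * (f $ y)\<^sup>2) - (\<Sum>y\<in>UNIV. p $ y * f $ y)\<^sup>2"
proof -
  have "f \<bullet> (diag_mat p *v f) = (\<Sum>y\<in>UNIV. p $ y * (f $ y)\<^sup>2)"
    by (simp add: inner_vec_def matrix_vector_mult_def diag_mat_def if_distrib if_distribR
        power2_eq_square mult_ac cong: if_cong)
  moreover have "f \<bullet> (outer_prod p p *v f) = (\<Sum>y\<in>UNIV. p $ y * f $ y)\<^sup>2"
    by (simp add: inner_vec_def matrix_vector_mult_def outer_prod_def power2_eq_square
        sum_product sum_distrib_left mult_ac)
  ultimately show ?thesis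
    by (simp add: matrix_vector_mult_diff_rdistrib inner_diff_right)
qed

lemma inner_K_op:
  "f \<bullet> (K_op K \<mu> g *v f)
     = (\<Sum>x\<in>UNIV. \<mu> $ x * ((\<Sum>y\<in>UNIV. tilted K g x $ y * (f $ y)\<^sup>2)
                         - (\<Sum>y\<in>UNIV. tilted K g x $ y * f $ y)\<^sup>2))"
proof -
  have "f \<bullet> ((\<Sum>x\<in>A. \<mu> $ x *\<^sub>R B x) *v f) = (\<Sum>x\<in>A. \<mu> $ x * (f \<bullet> (B x *v f)))"
    if "finite A" for A and B :: "_ \<Rightarrow> real ^ _ ^ _"
    using that
    by (induction A) (simp_all add: matrix_vector_mult_add_rdistrib inner_add_right
        scaleR_matrix_vector_assoc[symmetric])
  then show ?thesis
    by (simp add: K_op_def inner_covariance_matrix)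
qed

text \<open>
  With \<open>m\<close> the \<open>p\<close>-mean of \<open>f\<close>, the \<open>p\<close>-variance is the second moment of \<open>f - m\<close> under \<open>p\<close>, hence
  at least \<open>\<delta>\<close> times the one under \<open>q\<close>; and as \<open>f\<close> is centred under \<open>q\<close>, replacing \<open>f - m\<close> by \<open>f\<close>
  there only loses \<open>m\<^sup>2\<close>.
\<close>

lemma variance_comparison:
  fixes p q f :: "real ^ 'n"
  assumes p: "(\<Sum>y\<in>UNIV. p $ y) = 1" and q: "(\<Sum>y\<in>UNIV. q $ y) = 1"
    and centred: "expect q f = 0"
    and "0 \<le> \<delta>" and dom: "\<And>y. \<delta> * q $ y \<le> p $ y"
  shows "\<delta> * L2_norm_sq q f \<le> (\<Sum>y\<in>UNIV. p $ y * (f $ y)\<^sup>2) - (\<Sum>y\<in>UNIV. p $ y * f $ y)\<^sup>2"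
proof -
  define m where "m = (\<Sum>y\<in>UNIV. p $ y * f $ y)"
  have expand: "(\<Sum>y\<in>UNIV. w $ y * (f $ y - m)\<^sup>2)
      = L2_norm_sq w f - 2 * m * expect w f + m\<^sup>2" if "(\<Sum>y\<in>UNIV. w $ y) = 1" for w :: "real ^ 'n"
  proof -
    have "(\<Sum>y\<in>UNIV. w $ y * (f $ y - m)\<^sup>2)
        = L2_norm_sq w f - 2 * m * expect w f + m\<^sup>2 * (\<Sum>y\<in>UNIV. w $ y)"
      by (simp add: L2_norm_sq_def expect_def power2_diff algebra_simps sum.distrib
          sum_subtractf sum_distrib_left sum_distrib_right)
    then show ?thesis
      by (simp add: that)
  qed
  have "\<delta> * L2_norm_sq q f \<le> \<delta> * (\<Sum>y\<in>UNIV. q $ y * (f $ y - m)\<^sup>2)"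
    using \<open>0 \<le> \<delta>\<close> by (simp add: expand[OF q] centred mult_left_mono)
  also have "\<dots> = (\<Sum>y\<in>UNIV. (\<delta> * q $ y) * (f $ y - m)\<^sup>2)"
    by (simp add: sum_distrib_left mult_ac)
  also have "\<dots> \<le> (\<Sum>y\<in>UNIV. p $ y * (f $ y - m)\<^sup>2)"
    by (intro sum_mono mult_right_mono dom) simp
  also have "\<dots> = L2_norm_sq p f - m\<^sup>2"
  proof -
    have "expect p f = m"
      by (simp add: m_def expect_def)
    then show ?thesis
      unfolding expand[OF p] by (simp add: power2_eq_square)
  qed
  finally show ?thesis
    by (simp add: L2_norm_sq_def m_def)
qed

text \<open>
  On the gauge space the linear term of \<open>J\<close> vanishes, and the rest is an average of values
  \<open>ln (Z K g x)\<close>, each of which is at least \<open>ln c + g z\<close> by \<open>Z_ge_single\<close>.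
\<close>

lemma sublevel_upper_bound:
  assumes \<mu>: "is_prob_vec \<mu>"
    and "0 < c" and c: "\<And>x y. c \<le> K $ x $ y"
    and g: "g \<in> sublevel K \<mu> \<nu> g0"
  shows "g $ z \<le> J K \<mu> \<nu> g0 - ln c"
proof -
  have K: "K $ x $ y > 0" for x y
    using \<open>0 < c\<close> c[of x y] by linarith
  have "ln c + g $ z \<le> ln (Z K g x)" for x
  proof -
    have "c * exp (g $ z) \<le> K $ x $ z * exp (g $ z)"
      by (simp add: c)
    also have "\<dots> \<le> Z K g x"
      by (rule Z_ge_single) (rule K)
    finally have "ln (c * exp (g $ z)) \<le> ln (Z K g x)"
      using \<open>0 < c\<close> by (intro ln_mono) auto
    then show ?thesis
      using \<open>0 < c\<close> by (simp add: ln_mult)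
  qed
  then have "(\<Sum>x\<in>UNIV. \<mu> $ x * (ln c + g $ z)) \<le> (\<Sum>x\<in>UNIV. \<mu> $ x * ln (Z K g x))"
    using \<mu> by (intro sum_mono mult_left_mono) (auto simp: is_prob_vec_def)
  also have "\<dots> \<le> J K \<mu> \<nu> g0"
    using g by (simp add: sublevel_def gauge_space_def J_def)
  finally show ?thesis
    using \<mu> by (simp add: is_prob_vec_def flip: sum_distrib_right)
qed

text \<open>
  The nonnegative function \<open>M - g\<close> has mean \<open>M\<close>, so a single term of that mean is at most \<open>M\<close>.
\<close>

lemma centred_lower_bound:
  assumes \<nu>: "is_prob_vec \<nu>" and centred: "expect \<nu> g = 0"
    and M: "\<And>z. g $ z \<le> M"
  shows "\<nu> $ y * (M - g $ y) \<le> M"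
proof -
  have "\<nu> $ y * (M - g $ y) \<le> (\<Sum>z\<in>UNIV. \<nu> $ z * (M - g $ z))"
    by (rule member_le_sum[where f = "\<lambda>z. \<nu> $ z * (M - g $ z)"])
      (use \<nu> M in \<open>auto simp: is_prob_vec_def\<close>)
  also have "\<dots> = M * (\<Sum>z\<in>UNIV. \<nu> $ z) - expect \<nu> g"
    by (simp add: expect_def right_diff_distrib sum_subtractf sum_distrib_left mult_ac)
  also have "\<dots> = M"
    using \<nu> by (simp add: centred is_prob_vec_def)
  finally show ?thesis .
qed

text \<open>
  Only the oscillation of \<open>g\<close> matters here, as adding a constant to \<open>g\<close> leaves the tilted laws
  unchanged: the factor \<open>exp M\<close> of \<open>Z K g x\<close> cancels.
\<close>

lemma tilted_lower_bound:
  assumes "0 < c" and c: "\<And>x y. c \<le> K $ x $ y"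
    and C: "\<And>x. (\<Sum>y\<in>UNIV. K $ x $ y) \<le> C"
    and M: "\<And>z. g $ z \<le> M" and osc: "M - g $ y \<le> R"
  shows "c / C * exp (- R) \<le> tilted K g x $ y"
proof -
  have K: "K $ x $ y > 0" for x y
    using \<open>0 < c\<close> c[of x y] by linarith
  have "Z K g x \<le> (\<Sum>z\<in>UNIV. K $ x $ z * exp M)"
    unfolding Z_def using K M by (intro sum_mono mult_left_mono) (auto intro: less_imp_le)
  also have "\<dots> \<le> C * exp M"
    using C by (simp flip: sum_distrib_right)
  finally have Z: "Z K g x \<le> C * exp M" .
  have num: "c * exp (M - R) \<le> K $ x $ y * exp (g $ y)"
    using \<open>0 < c\<close> c osc K by (intro mult_mono) (auto intro: less_imp_le)
  have "c / C * exp (- R) = c * exp (M - R) / (C * exp M)"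
    by (simp add: exp_diff exp_minus divide_inverse)
  also have "\<dots> \<le> K $ x $ y * exp (g $ y) / Z K g x"
    using \<open>0 < c\<close> K[of x y] Z_pos[OF K, of g x] by (intro frac_le num Z) auto
  finally show ?thesis
    by (simp add: tilted_def)
qed

theorem theorem5p1:
  fixes Q K :: "real ^ 'n ^ 'n" and \<mu> \<nu> g0 :: "real ^ 'n"
  assumes "is_generator Q"
    and "K = mat_exp Q"
    and "is_prob_vec \<mu>"
    and "is_prob_vec \<nu>"
    and "\<And>x y. K $ x $ y > 0"
    and "\<And>x. \<mu> $ x > 0"
    and "\<And>y. \<nu> $ y > 0"
    and "g0 \<in> gauge_space \<nu>"
  shows "\<exists>l>0. \<forall>g \<in> sublevel K \<mu> \<nu> g0. \<forall>f :: real ^ 'n. expect \<nu> f = 0 \<longrightarrow>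
           f \<bullet> (K_op K \<mu> g *v f) \<ge> l * L2_norm_sq \<nu> f"
proof -
  note \<mu> = \<open>is_prob_vec \<mu>\<close> and \<nu> = \<open>is_prob_vec \<nu>\<close>
  define c where "c = Min (range (\<lambda>(x, y). K $ x $ y))"
  define n where "n = Min (range (\<lambda>y. \<nu> $ y))"
  define C where "C = (\<Sum>x\<in>UNIV. \<Sum>y\<in>UNIV. K $ x $ y)"
  define M where "M = J K \<mu> \<nu> g0 - ln c"
  \<comment> \<open>\<open>M\<close> bounds every \<open>g\<close> in the sublevel set from above, and \<open>M / n\<close> bounds \<open>M - g\<close>.\<close>
  define \<delta> where "\<delta> = c / C * exp (- (M / n))"
  have "0 < c" and c: "c \<le> K $ x $ y" for x y
    using assms(5) by (auto simp: c_def intro!: Min_le)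
  have "0 < n" and n: "n \<le> \<nu> $ y" for y
    using assms(7) by (auto simp: n_def)
  have "0 < C"
    unfolding C_def using assms(5) by (intro sum_pos) auto
  have C: "(\<Sum>y\<in>UNIV. K $ x $ y) \<le> C" for x
    unfolding C_def
    by (rule member_le_sum[where f = "\<lambda>x. \<Sum>y\<in>UNIV. K $ x $ y"])
      (use assms(5) in \<open>auto intro!: sum_nonneg intro: less_imp_le\<close>)
  have "0 < \<delta>"
    using \<open>0 < c\<close> \<open>0 < C\<close> by (simp add: \<delta>_def)
  moreover have "\<delta> * L2_norm_sq \<nu> f \<le> f \<bullet> (K_op K \<mu> g *v f)"
    if g: "g \<in> sublevel K \<mu> \<nu> g0" and f: "expect \<nu> f = 0" for g f
  proof -
    have M: "g $ z \<le> M" for z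
      unfolding M_def by (rule sublevel_upper_bound[OF \<mu> \<open>0 < c\<close> c g])
    have osc: "M - g $ y \<le> M / n" for y
    proof -
      have "n * (M - g $ y) \<le> \<nu> $ y * (M - g $ y)"
        using n M by (intro mult_right_mono) auto
      also have "\<dots> \<le> M"
        using g by (intro centred_lower_bound[OF \<nu> _ M]) (simp add: sublevel_def gauge_space_def)
      finally show ?thesis
        using \<open>0 < n\<close> by (simp add: field_simps)
    qed
    have dom: "\<delta> * \<nu> $ y \<le> tilted K g x $ y" for x y
    proof -
      have "\<nu> $ y \<le> (\<Sum>z\<in>UNIV. \<nu> $ z)"
        by (rule member_le_sum) (use assms(7) in \<open>auto intro: less_imp_le\<close>)
      then have "\<delta> * \<nu> $ y \<le> \<delta>"
        using \<open>0 < \<delta>\<close> \<nu> by (simp add: is_prob_vec_def)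
      also have "\<delta> \<le> tilted K g x $ y"
        unfolding \<delta>_def by (rule tilted_lower_bound[OF \<open>0 < c\<close> c C M osc])
      finally show ?thesis .
    qed
    have "\<delta> * L2_norm_sq \<nu> f = (\<Sum>x\<in>UNIV. \<mu> $ x * (\<delta> * L2_norm_sq \<nu> f))"
      using \<mu> by (simp add: is_prob_vec_def flip: sum_distrib_right)
    also have "\<dots> \<le> f \<bullet> (K_op K \<mu> g *v f)"
      unfolding inner_K_op
      using \<mu> \<nu> \<open>0 < \<delta>\<close>
      by (intro sum_mono mult_left_mono variance_comparison sum_tilted assms(5) f dom)
        (auto simp: is_prob_vec_def)
    finally show ?thesis .
  qed
  ultimately show ?thesis
    by blast
qed

end
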